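(* Consider the Gaussian sequence model $X_i=\theta_i+\varepsilon_i$, $1\le i\le n$, $\varepsilon_i$ i.i.d. $\mathcal N(0,1)$, and the classes (with fixed $0<a<b$) $$\Theta(r,\beta)=\bigcup_{s_n\in[an^{1-\beta},\,bn^{1-\beta}]}\{\theta\in\mathbb R^n:\ |S_\theta|=s_n,\ |\theta_i|\ge \sqrt{2r\log n}\ \text{for all } i\in S_\theta\}.$$ Let $\varepsilon>0$ and $$\mathcal J=\mathcal J(\varepsilon)=\{(\beta,r):\ \beta\in[\varepsilon,1-\varepsilon],\ \beta+\varepsilon\le r\le(1+\sqrt{1-\beta})^2-\varepsilon\}.$$ There exists a procedure $\varphi=\varphi(X)$ (not depending on $(\beta,r)$) and a finite constant $C=C(a,b,\varepsilon)>0$ such that, for $n$ large enough, $$\sup_{(\beta,r)\in\mathcal J}\ \sup_{\theta\in\Theta(r,\beta)}\frac{E_\theta L_C(\theta,\varphi)}{v_C(r,\beta)}\le C,$$ and the same holds for the $\mathfrak R$-risk, upon replacing $E_\theta L_C(\theta,\varphi)/v_C(r,\beta)$ by $\mathfrak R(\theta,\varphi)/v_R(r,\beta)$.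
   Context: $\theta\in\mathbb R^n$ is deterministic; $P_\theta,E_\theta$ denote the law of $X$ and its expectation; $S_\theta=\{i:\theta_i\ne0\}$; the union is over integers $s_n$. For $0<\beta<r$, $\kappa=\kappa(r,\beta)$ is defined by $\sqrt\kappa=(\sqrt r-\beta/\sqrt r)/2$, and $v_R(r,\beta)=n^{-\kappa}/\sqrt{\log n}$, $v_C(r,\beta)=n^{1-\beta}v_R(r,\beta)$. A multiple testing procedure is a measurable $\varphi:\mathbb R^n\to\{0,1\}^n$. $\mathrm{FDR}(\theta,\varphi)=E_\theta\left[\frac{\sum_i\mathbf 1\{\theta_i=0\}\varphi_i(X)}{1\vee\sum_i\varphi_i(X)}\right]$, $\mathrm{FNR}(\theta,\varphi)=E_\theta\left[\frac{\sum_i\mathbf 1\{\theta_i\ne0\}(1-\varphi_i(X))}{1\vee|S_\theta|}\right]$, $\mathfrak R=\mathrm{FDR}+\mathrm{FNR}$; $L_C(\theta,\varphi)=\sum_{i=1}^n(\mathbf 1\{\theta_i=0\}\mathbf 1\{\varphi_i\ne0\}+\mathbf 1\{\theta_i\ne0\}\mathbf 1\{\varphi_i=0\})$. *)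

theory Defs
  imports "HOL-Probability.Probability"
begin

text \<open>
  Vectors indexed by \<open>1, \<dots>, n\<close>, with \<open>n\<close> varying, are functions on \<open>nat\<close> that are
  \<open>undefined\<close> outside \<open>{1..n}\<close>; the corresponding space is the finite product over \<open>{1..n}\<close>.
\<close>

definition vec_space :: "nat \<Rightarrow> (nat \<Rightarrow> real) measure" where
  "vec_space n = PiM {1..n} (\<lambda>_. borel)"

definition gauss_noise :: "nat \<Rightarrow> (nat \<Rightarrow> real) measure" where
  "gauss_noise n = PiM {1..n} (\<lambda>_. density lborel (\<lambda>x. ennreal (std_normal_density x)))"

text \<open>The law of \<open>X = \<theta> + \<epsilon>\<close> with \<open>\<epsilon>\<close> distributed as \<^term>\<open>gauss_noise n\<close>.\<close>

definition law :: "nat \<Rightarrow> (nat \<Rightarrow> real) \<Rightarrow> (nat \<Rightarrow> real) measure" where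
  "law n \<theta> = distr (gauss_noise n) (vec_space n) (\<lambda>e. \<lambda>i\<in>{1..n}. \<theta> i + e i)"

definition supp :: "nat \<Rightarrow> (nat \<Rightarrow> real) \<Rightarrow> nat set" where
  "supp n \<theta> = {i \<in> {1..n}. \<theta> i \<noteq> 0}"

definition Theta :: "real \<Rightarrow> real \<Rightarrow> nat \<Rightarrow> real \<Rightarrow> real \<Rightarrow> (nat \<Rightarrow> real) set" where
  "Theta a b n r \<beta> =
     (\<Union>s \<in> {s::int. a * real n powr (1 - \<beta>) \<le> real_of_int s \<and>
                     real_of_int s \<le> b * real n powr (1 - \<beta>)}.
        {\<theta> \<in> {1..n} \<rightarrow>\<^sub>E UNIV. int (card (supp n \<theta>)) = s \<and>
           (\<forall>i \<in> supp n \<theta>. \<bar>\<theta> i\<bar> \<ge> sqrt (2 * r * ln (real n)))})"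

definition procedure :: "nat \<Rightarrow> ((nat \<Rightarrow> real) \<Rightarrow> nat \<Rightarrow> nat) \<Rightarrow> bool" where
  "procedure n \<phi> \<longleftrightarrow> \<phi> \<in> vec_space n \<rightarrow>\<^sub>M PiM {1..n} (\<lambda>_. count_space {0, 1})"

definition FDR :: "nat \<Rightarrow> (nat \<Rightarrow> real) \<Rightarrow> ((nat \<Rightarrow> real) \<Rightarrow> nat \<Rightarrow> nat) \<Rightarrow> real" where
  "FDR n \<theta> \<phi> = (\<integral>x. (\<Sum>i=1..n. of_bool (\<theta> i = 0) * real (\<phi> x i)) /
                      max 1 (\<Sum>i=1..n. real (\<phi> x i)) \<partial>law n \<theta>)"

definition FNR :: "nat \<Rightarrow> (nat \<Rightarrow> real) \<Rightarrow> ((nat \<Rightarrow> real) \<Rightarrow> nat \<Rightarrow> nat) \<Rightarrow> real" where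
  "FNR n \<theta> \<phi> = (\<integral>x. (\<Sum>i=1..n. of_bool (\<theta> i \<noteq> 0) * (1 - real (\<phi> x i))) /
                      max 1 (real (card (supp n \<theta>))) \<partial>law n \<theta>)"

definition R_risk :: "nat \<Rightarrow> (nat \<Rightarrow> real) \<Rightarrow> ((nat \<Rightarrow> real) \<Rightarrow> nat \<Rightarrow> nat) \<Rightarrow> real" where
  "R_risk n \<theta> \<phi> = FDR n \<theta> \<phi> + FNR n \<theta> \<phi>"

definition L_C :: "nat \<Rightarrow> (nat \<Rightarrow> real) \<Rightarrow> (nat \<Rightarrow> nat) \<Rightarrow> real" where
  "L_C n \<theta> d = (\<Sum>i=1..n. of_bool (\<theta> i = 0) * of_bool (d i \<noteq> 0) +
                            of_bool (\<theta> i \<noteq> 0) * of_bool (d i = 0))"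

definition C_risk :: "nat \<Rightarrow> (nat \<Rightarrow> real) \<Rightarrow> ((nat \<Rightarrow> real) \<Rightarrow> nat \<Rightarrow> nat) \<Rightarrow> real" where
  "C_risk n \<theta> \<phi> = (\<integral>x. L_C n \<theta> (\<phi> x) \<partial>law n \<theta>)"

text \<open>Only used for \<open>0 < \<beta> < r\<close>, where the squared quantity is positive.\<close>

definition kappa :: "real \<Rightarrow> real \<Rightarrow> real" where
  "kappa r \<beta> = ((sqrt r - \<beta> / sqrt r) / 2)\<^sup>2"

definition v_R :: "nat \<Rightarrow> real \<Rightarrow> real \<Rightarrow> real" where
  "v_R n r \<beta> = real n powr (- kappa r \<beta>) / sqrt (ln (real n))"

definition v_C :: "nat \<Rightarrow> real \<Rightarrow> real \<Rightarrow> real" where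
  "v_C n r \<beta> = real n powr (1 - \<beta>) * v_R n r \<beta>"

definition J :: "real \<Rightarrow> (real \<times> real) set" where
  "J \<epsilon> = {(\<beta>, r). \<beta> \<in> {\<epsilon>..1 - \<epsilon>} \<and> \<beta> + \<epsilon> \<le> r \<and> r \<le> (1 + sqrt (1 - \<beta>))\<^sup>2 - \<epsilon>}"

end

theory Submission
  imports Defs "HOL-Real_Asymp.Real_Asymp"
begin

text \<open>
  With \<open>V\<^sub>k\<close> false and \<open>N\<^sub>k\<close> total rejections at the threshold \<open>x\<^sub>i\<^sup>2 \<ge> 2 k\<close>, the number of errors is
  \<open>|S\<^sub>\<theta>| + 2 V\<^sub>k - N\<^sub>k\<close>. Let \<open>G\<^sub>k = n exp (- k) / sqrt (2 k)\<close>, a bound for the mean of \<open>V\<^sub>k\<close>, and let the level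
  minimise \<open>4 G\<^sub>k - N\<^sub>k\<close> over about \<open>log n\<close> values of \<open>k\<close>. Its error count then exceeds that of any
  fixed level \<open>k\<close> by at most \<open>4 G\<^sub>k + 2 max\<^sub>j (V\<^sub>j - 2 G\<^sub>j)\<close>. Since \<open>V\<^sub>j\<close> is a sum of independent
  indicators, \<open>exp (V\<^sub>j - 2 G\<^sub>j)\<close> has mean at most 1, so the maximum costs only \<open>O(log n)\<close>, which is
  negligible because \<open>1 - \<beta> - \<kappa>\<close> is bounded away from 0 on \<open>J\<close>. The level
  \<open>k = ceiling ((\<kappa> + \<beta>) log n)\<close> attains the rate by the Gaussian tail bound. For the other risk, the
  false discovery proportion never exceeds twice the number of errors divided by \<open>|S\<^sub>\<theta>|\<close>: this
  holds trivially if more than half of the signals are missed, and otherwise at least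
  \<open>|S\<^sub>\<theta>| / 2\<close> hypotheses are rejected.
\<close>

section \<open>Gaussian tail bounds\<close>

definition std_normal :: "real measure" where
  "std_normal = density lborel (\<lambda>x. ennreal (std_normal_density x))"

lemma prob_space_std_normal: "prob_space std_normal"
  unfolding std_normal_def by (rule prob_space_normal_density) simp

lemma sets_std_normal [measurable_cong, simp]: "sets std_normal = sets borel"
  by (simp add: std_normal_def)

lemma space_std_normal [simp]: "space std_normal = UNIV"
  by (simp add: std_normal_def)

text \<open>On \<open>{w..}\<close> the factor \<open>x / w\<close> is at least 1, and inserting it
  turns the density into the exact derivative of \<open>- std_normal_density x / w\<close>. The 2 in
  the bound comes from \<open>2 \<le> sqrt (2 * pi)\<close>.\<close>

lemma emeasure_std_normal_tail:
  fixes w :: real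
  assumes "0 < w"
  shows "emeasure std_normal {w..} \<le> ennreal (exp (- w\<^sup>2 / 2) / (2 * w))"
proof -
  define F where "F = (\<lambda>x::real. - std_normal_density x / w)"
  have "emeasure std_normal {w..} = (\<integral>\<^sup>+x. ennreal (std_normal_density x) * indicator {w..} x \<partial>lborel)"
    unfolding std_normal_def by (subst emeasure_density) auto
  also have "\<dots> \<le> (\<integral>\<^sup>+x. ennreal (std_normal_density x * x / w) * indicator {w..} x \<partial>lborel)"
    using assms by (intro nn_integral_mono)
      (auto simp: indicator_def pos_le_divide_eq intro!: ennreal_leI mult_left_mono)
  also have "\<dots> = ennreal (0 - F w)"
  proof (rule nn_integral_FTC_atLeast)
    show "DERIV F x :> std_normal_density x * x / w" for x
      unfolding F_def std_normal_density_def using assms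
      by (auto intro!: derivative_eq_intros simp: field_simps)
    show "(F \<longlongrightarrow> 0) at_top"
      unfolding F_def std_normal_density_def using assms by real_asymp
  qed (use assms in auto)
  also have "0 - F w = exp (- w\<^sup>2 / 2) / (sqrt (2 * pi) * w)"
    by (simp add: F_def std_normal_density_def)
  also have "\<dots> \<le> exp (- w\<^sup>2 / 2) / (2 * w)"
  proof -
    have "2 \<le> sqrt (2 * pi)"
      using pi_ge_two by (intro real_le_rsqrt) auto
    then show ?thesis
      using assms by (intro divide_left_mono mult_right_mono) auto
  qed
  finally show ?thesis by (simp add: ennreal_leI)
qed

lemma emeasure_std_normal_uminus:
  assumes [measurable]: "A \<in> sets borel"
  shows "emeasure std_normal (uminus -` A) = emeasure std_normal A"
proof -
  have [measurable]: "uminus -` A \<in> sets (borel :: real measure)"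
    using measurable_sets[of uminus borel borel A] by simp
  have "emeasure std_normal (uminus -` A)
      = (\<integral>\<^sup>+x. ennreal (std_normal_density x) * indicator (uminus -` A) x \<partial>lborel)"
    unfolding std_normal_def by (subst emeasure_density) auto
  also have "\<dots> = (\<integral>\<^sup>+x. ennreal (std_normal_density x) * indicator A x \<partial>lborel)"
    by (subst nn_integral_real_affine[of _ "-1" 0])
      (auto simp: std_normal_density_def indicator_def intro!: nn_integral_cong)
  also have "\<dots> = emeasure std_normal A"
    unfolding std_normal_def by (subst emeasure_density) auto
  finally show ?thesis .
qed

lemma std_normal_two_sided_tail:
  fixes w :: real
  assumes "0 < w"
  shows "measure std_normal {z. w \<le> \<bar>z\<bar>} \<le> exp (- w\<^sup>2 / 2) / w"
proof -
  interpret prob_space std_normal by (rule prob_space_std_normal)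
  have lower: "uminus -` {w..} = {..- w}"
    by (auto simp: le_minus_iff)
  have "measure std_normal {..- w} = measure std_normal {w..}"
    unfolding measure_def lower[symmetric] by (subst emeasure_std_normal_uminus) auto
  moreover have "{z. w \<le> \<bar>z\<bar>} = {w..} \<union> {..- w}"
    by (auto simp: abs_if split: if_splits)
  ultimately have "measure std_normal {z. w \<le> \<bar>z\<bar>} \<le> 2 * measure std_normal {w..}"
    using measure_Un_le[of "{w..}" std_normal "{..- w}"] by simp
  also have "measure std_normal {w..} \<le> exp (- w\<^sup>2 / 2) / (2 * w)"
    using emeasure_std_normal_tail[OF assms] assms by (simp add: emeasure_eq_measure)
  finally show ?thesis by simp
qed

section \<open>The data-driven level and pointwise bounds on its errors\<close>

definition penalty :: "nat \<Rightarrow> nat \<Rightarrow> real" where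
  "penalty n k = real n * (exp (- real k) / sqrt (2 * real k))"

text \<open>Up to the constant number of signals, the error count is twice the false rejections
  minus all rejections. The false rejections are not observable; \<open>2 * penalty n k\<close>, the
  size at which their exponential moment is controlled, stands in for them, hence the factor
  4.\<close>

definition crit :: "nat \<Rightarrow> nat \<Rightarrow> (nat \<Rightarrow> real) \<Rightarrow> real" where
  "crit n k x = 4 * penalty n k - (\<Sum>i=1..n. of_bool (2 * real k \<le> (x i)\<^sup>2))"

text \<open>The ceiling leaves room for every level \<open>ceiling (c * ln n)\<close> with
  \<open>c \<le> 1\<close>. The \<open>Suc\<close> keeps the range nonempty for every
  \<open>n\<close>, so that a minimiser exists.\<close>

definition levels :: "nat \<Rightarrow> nat" where
  "levels n = Suc (nat \<lceil>ln (real n)\<rceil>)"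

text \<open>Breaking ties by \<open>LEAST\<close> makes the level the least index satisfying
  measurable predicates, hence measurable in the data.\<close>

definition level :: "nat \<Rightarrow> (nat \<Rightarrow> real) \<Rightarrow> nat" where
  "level n x = (LEAST k. k \<in> {1..levels n} \<and> (\<forall>j\<in>{1..levels n}. crit n k x \<le> crit n j x))"

text \<open>The restriction to \<open>{1..n}\<close> puts the output into the product space that
  \<open>procedure\<close> asks for.\<close>

definition threshold_test :: "nat \<Rightarrow> nat \<Rightarrow> (nat \<Rightarrow> real) \<Rightarrow> nat \<Rightarrow> nat" where
  "threshold_test n k x = (\<lambda>i\<in>{1..n}. of_bool (2 * real k \<le> (x i)\<^sup>2))"

definition adaptive_test :: "nat \<Rightarrow> (nat \<Rightarrow> real) \<Rightarrow> nat \<Rightarrow> nat" where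
  "adaptive_test n x = threshold_test n (level n x) x"

definition false_pos :: "nat \<Rightarrow> (nat \<Rightarrow> real) \<Rightarrow> nat \<Rightarrow> (nat \<Rightarrow> real) \<Rightarrow> real" where
  "false_pos n \<theta> k x = (\<Sum>i=1..n. of_bool (\<theta> i = 0) * of_bool (2 * real k \<le> (x i)\<^sup>2))"

lemma level_minimizes:
  shows "level n x \<in> {1..levels n}"
    and "j \<in> {1..levels n} \<Longrightarrow> crit n (level n x) x \<le> crit n j x"
proof -
  have "\<exists>k\<in>{1..levels n}. \<forall>j\<in>{1..levels n}. crit n k x \<le> crit n j x"
    using ex_min_if_finite[of "(\<lambda>k. crit n k x) ` {1..levels n}"]
    by (auto simp: levels_def not_less)
  then have "level n x \<in> {1..levels n} \<and> (\<forall>j\<in>{1..levels n}. crit n (level n x) x \<le> crit n j x)"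
    unfolding level_def by - (rule LeastI_ex, blast)
  then show "level n x \<in> {1..levels n}"
    and "j \<in> {1..levels n} \<Longrightarrow> crit n (level n x) x \<le> crit n j x" by auto
qed

lemma measurable_crit: "crit n k \<in> borel_measurable (vec_space n)"
  unfolding crit_def vec_space_def by measurable

lemma measurable_level [measurable]: "level n \<in> vec_space n \<rightarrow>\<^sub>M count_space UNIV"
proof -
  have [measurable]: "Measurable.pred (vec_space n) (\<lambda>x. crit n k x \<le> crit n j x)" for k j
    unfolding pred_def by (intro borel_measurable_le measurable_crit)
  show ?thesis unfolding level_def by measurable
qed

lemma measurable_threshold [measurable]:
  assumes "i \<in> {1..n}"
  shows "Measurable.pred (vec_space n) (\<lambda>x. 2 * real (level n x) \<le> (x i)\<^sup>2)"
proof -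
  have [measurable]: "(\<lambda>x. x i) \<in> borel_measurable (vec_space n)"
    unfolding vec_space_def using assms by measurable
  show ?thesis by measurable
qed

lemma procedure_adaptive_test: "procedure n (adaptive_test n)"
  unfolding procedure_def adaptive_test_def threshold_test_def
proof (rule measurable_restrict)
  fix i assume i: "i \<in> {1..n}"
  note [measurable] = measurable_threshold[OF i]
  have "(\<lambda>x. if 2 * real (level n x) \<le> (x i)\<^sup>2 then 1 else 0::nat)
      \<in> vec_space n \<rightarrow>\<^sub>M count_space {0, 1}"
    by (rule measurable_If) auto
  then show "(\<lambda>x. of_bool (2 * real (level n x) \<le> (x i)\<^sup>2)) \<in> vec_space n \<rightarrow>\<^sub>M count_space {0, 1}"
    by (simp add: of_bool_def)
qed

text \<open>Correct rejections are all rejections minus the false ones, so the missed signals are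
  the signals minus this difference; the false rejections are then counted a second time as errors
  of their own.\<close>

lemma L_C_threshold_test:
  "L_C n \<theta> (threshold_test n k x)
     = real (card (supp n \<theta>)) + 2 * false_pos n \<theta> k x - (\<Sum>i=1..n. of_bool (2 * real k \<le> (x i)\<^sup>2))"
proof -
  have s: "real (card (supp n \<theta>)) = (\<Sum>i=1..n. of_bool (\<theta> i \<noteq> 0))"
    by (simp add: supp_def of_bool_def sum.If_cases Int_def)
  show ?thesis
    unfolding s L_C_def false_pos_def
    unfolding sum_distrib_left sum.distrib[symmetric] sum_subtractf[symmetric]
    by (auto intro!: sum.cong simp: threshold_test_def)
qed

text \<open>Minimality of \<open>crit\<close> trades the rejections at the random level for those at
  \<open>k\<close>, leaving twice \<open>false_pos - 2 * penalty\<close> at the random level. A sum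
  over all levels replaces this term, because its mean can be bounded summand by summand.\<close>

lemma L_C_adaptive_test_le:
  assumes "k \<in> {1..levels n}"
  shows "L_C n \<theta> (adaptive_test n x)
     \<le> L_C n \<theta> (threshold_test n k x) + 4 * penalty n k
       + 2 * (\<Sum>j=1..levels n. exp (false_pos n \<theta> j x - 2 * penalty n j))"
proof -
  let ?l = "level n x"
  have "0 \<le> false_pos n \<theta> k x"
    by (simp add: false_pos_def sum_nonneg)
  \<comment> \<open>From \<open>y \<le> exp y\<close>; positivity of the exponentials then allows
    the single term to be enlarged to the sum.\<close>
  have "false_pos n \<theta> ?l x - 2 * penalty n ?l \<le> exp (false_pos n \<theta> ?l x - 2 * penalty n ?l)"
    using exp_ge_add_one_self[of "false_pos n \<theta> ?l x - 2 * penalty n ?l"] by linarith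
  also have "\<dots> \<le> (\<Sum>j=1..levels n. exp (false_pos n \<theta> j x - 2 * penalty n j))"
    using level_minimizes(1) by (intro member_le_sum) auto
  finally show ?thesis
    using level_minimizes(2)[OF assms, of x] \<open>0 \<le> false_pos n \<theta> k x\<close>
    unfolding adaptive_test_def L_C_threshold_test crit_def by linarith
qed

lemma false_discovery_proportion_le:
  assumes "supp n \<theta> \<noteq> {}" and d: "\<And>i. i \<in> {1..n} \<Longrightarrow> d i \<in> {0, 1}"
  shows "(\<Sum>i=1..n. of_bool (\<theta> i = 0) * real (d i)) / max 1 (\<Sum>i=1..n. real (d i))
     \<le> 2 * (L_C n \<theta> d / real (card (supp n \<theta>)))"
proof -
  define V where "V = (\<Sum>i=1..n. of_bool (\<theta> i = 0) * real (d i))"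
  define W where "W = (\<Sum>i=1..n. of_bool (\<theta> i \<noteq> 0) * (1 - real (d i)))"
  define s where "s = real (card (supp n \<theta>))"
  have "finite (supp n \<theta>)" by (simp add: supp_def)
  then have s: "0 < s"
    using assms(1) by (simp add: s_def card_gt_0_iff)
  have s_eq: "s = (\<Sum>i=1..n. of_bool (\<theta> i \<noteq> 0))"
    by (simp add: s_def supp_def of_bool_def sum.If_cases Int_def)
  have R: "(\<Sum>i=1..n. real (d i)) = V + s - W"
    unfolding V_def W_def s_eq sum.distrib[symmetric] sum_subtractf[symmetric]
    by (auto intro!: sum.cong)
  have L: "L_C n \<theta> d = V + W"
    unfolding V_def W_def L_C_def sum.distrib[symmetric]
    by (intro sum.cong) (use d in \<open>fastforce+\<close>)
  have V: "0 \<le> V" unfolding V_def by (intro sum_nonneg) auto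
  have W: "0 \<le> W" unfolding W_def using d by (intro sum_nonneg) fastforce
  have WS: "W \<le> s"
    unfolding W_def s_eq by (intro sum_mono) auto
  have "V / max 1 (V + s - W) \<le> 2 * ((V + W) / s)"
  proof (cases "2 * W \<le> s")
    case True
    have "V / max 1 (V + s - W) \<le> V / (s / 2)"
      using s V True by (intro divide_left_mono) (auto simp: le_max_iff_disj)
    also have "\<dots> = 2 * (V / s)"
      by simp
    also have "\<dots> \<le> 2 * ((V + W) / s)"
      using s W by (intro mult_left_mono divide_right_mono) auto
    finally show ?thesis .
  next
    case False
    \<comment> \<open>No more signals are missed than exist, so the rejections number at least
      \<open>V\<close>.\<close>
    have "V / max 1 (V + s - W) \<le> 1"
      using V WS by (simp add: pos_divide_le_eq le_max_iff_disj)
    also have "1 \<le> 2 * ((V + W) / s)"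
      using False s V by (simp add: pos_le_divide_eq)
    finally show ?thesis .
  qed
  then show ?thesis
    unfolding R L by (simp add: V_def s_def)
qed


section \<open>Expectations under the law of the observations\<close>

lemma gauss_noise_eq: "gauss_noise n = PiM {1..n} (\<lambda>_. std_normal)"
  by (simp add: gauss_noise_def std_normal_def)

lemma measurable_shift [measurable]:
  fixes \<theta> :: "nat \<Rightarrow> real"
  shows "(\<lambda>e. \<lambda>i\<in>{1..n}. \<theta> i + e i) \<in> gauss_noise n \<rightarrow>\<^sub>M vec_space n"
  unfolding gauss_noise_eq vec_space_def
proof (rule measurable_restrict)
  fix i assume "i \<in> {1..n}"
  then have "(\<lambda>e. e i) \<in> PiM {1..n} (\<lambda>_. std_normal) \<rightarrow>\<^sub>M std_normal"
    by (rule measurable_component_singleton)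
  then have [measurable]: "(\<lambda>e. e i) \<in> PiM {1..n} (\<lambda>_. std_normal) \<rightarrow>\<^sub>M borel"
    unfolding measurable_cong_sets[OF refl sets_std_normal] .
  show "(\<lambda>e. \<theta> i + e i) \<in> PiM {1..n} (\<lambda>_. std_normal) \<rightarrow>\<^sub>M borel"
    by measurable
qed

lemma finite_product_prob_space_std_normal:
  "finite_product_prob_space (\<lambda>_. std_normal) {1..n::nat}"
  unfolding finite_product_prob_space_def finite_product_sigma_finite_def
    finite_product_sigma_finite_axioms_def
  using product_prob_spaceI[of "\<lambda>_::nat. std_normal"] prob_space_std_normal
  by (auto simp: product_prob_space_def)

lemma prob_space_law: "prob_space (law n \<theta>)"
proof -
  interpret finite_product_prob_space "\<lambda>_. std_normal" "{1..n}"
    by (rule finite_product_prob_space_std_normal)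
  have "prob_space (gauss_noise n)"
    unfolding gauss_noise_eq by (rule prob_space_axioms)
  then show ?thesis
    unfolding law_def by (rule prob_space.prob_space_distr) measurable
qed

lemma measurable_law_component:
  assumes "i \<in> {1..n}"
  shows "(\<lambda>x. x i) \<in> borel_measurable (law n \<theta>)"
  using assms unfolding law_def vec_space_def by simp

lemma integral_law_component:
  fixes P :: "real \<Rightarrow> bool"
  assumes i: "i \<in> {1..n}" and [measurable]: "Measurable.pred borel P"
  shows "(\<integral>x. of_bool (P (x i)) \<partial>law n \<theta>) = measure std_normal {z. P (\<theta> i + z)}"
proof -
  interpret finite_product_prob_space "\<lambda>_. std_normal" "{1..n}"
    by (rule finite_product_prob_space_std_normal)
  have meas: "(\<lambda>z. of_bool (P (\<theta> i + z)) :: real) \<in> borel_measurable std_normal"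
    by measurable
  have [measurable]: "(\<lambda>x. x i) \<in> borel_measurable (vec_space n)"
    unfolding vec_space_def using i by measurable
  have comp: "(\<lambda>e. e i) \<in> PiM {1..n} (\<lambda>_. std_normal) \<rightarrow>\<^sub>M std_normal"
    using i by (rule measurable_component_singleton)
  have "(\<integral>x. (of_bool (P (x i)) :: real) \<partial>law n \<theta>)
      = (\<integral>e. of_bool (P ((\<lambda>i\<in>{1..n}. \<theta> i + e i) i)) \<partial>gauss_noise n)"
    unfolding law_def by (rule integral_distr) measurable
  also have "\<dots> = (\<integral>e. of_bool (P (\<theta> i + e i)) \<partial>PiM {1..n} (\<lambda>_. std_normal))"
    using i unfolding gauss_noise_eq by simp
  also have "\<dots> = (\<integral>z. of_bool (P (\<theta> i + z))
      \<partial>distr (PiM {1..n} (\<lambda>_. std_normal)) std_normal (\<lambda>e. e i))"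
    by (rule integral_distr[OF comp meas, symmetric])
  also have "\<dots> = (\<integral>z. indicator {z. P (\<theta> i + z)} z \<partial>std_normal)"
    unfolding PiM_component[OF i] indicator_def by simp
  also have "\<dots> = measure std_normal {z. P (\<theta> i + z)}"
    by (simp only: Bochner_Integration.integral_indicator space_std_normal Int_UNIV_right)
  finally show ?thesis .
qed

text \<open>Cutting the square at \<open>2 * real k\<close> makes the Gaussian exponent exactly
  \<open>- real k\<close>; this is the source of the formula for \<open>penalty\<close>.\<close>

lemma std_normal_exceed_le:
  assumes "1 \<le> k"
  shows "measure std_normal {z. 2 * real k \<le> z\<^sup>2} \<le> exp (- real k) / sqrt (2 * real k)"
proof -
  have "{z. 2 * real k \<le> z\<^sup>2} = {z. sqrt (2 * real k) \<le> \<bar>z\<bar>}"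
    by (auto simp: real_le_lsqrt real_sqrt_le_iff simp flip: real_sqrt_abs)
  then show ?thesis
    using std_normal_two_sided_tail[of "sqrt (2 * real k)"] assms by simp
qed

text \<open>A miss brings \<open>t + z\<close> below the threshold in absolute value, so by the
  triangle inequality the noise alone must have size at least \<open>w\<close>.\<close>

lemma std_normal_miss_le:
  assumes "sqrt (2 * real k) + w \<le> \<bar>t\<bar>" "0 < w"
  shows "measure std_normal {z. \<not> 2 * real k \<le> (t + z)\<^sup>2} \<le> exp (- w\<^sup>2 / 2) / w"
proof -
  interpret prob_space std_normal by (rule prob_space_std_normal)
  have "w \<le> \<bar>z\<bar>" if "\<not> 2 * real k \<le> (t + z)\<^sup>2" for z
  proof -
    have "\<bar>t + z\<bar> < sqrt (2 * real k)"
      using that by (simp add: not_le flip: real_sqrt_abs)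
    then show ?thesis using assms by linarith
  qed
  then have "measure std_normal {z. \<not> 2 * real k \<le> (t + z)\<^sup>2} \<le> measure std_normal {z. w \<le> \<bar>z\<bar>}"
    by (intro finite_measure_mono) auto
  with std_normal_two_sided_tail[OF assms(2)] show ?thesis by simp
qed

text \<open>By independence the exponential moment is a product over coordinates. A null factor has
  mean \<open>1 + (exp 1 - 1) * p\<close> with \<open>p \<le> q\<close>, a signal factor is 1, and
  both are at most \<open>exp (2 * q)\<close>; the \<open>n\<close> factors multiply to
  \<open>exp (2 * penalty n k)\<close>.\<close>

lemma integral_exp_false_pos:
  assumes "1 \<le> k"
  shows "integrable (law n \<theta>) (\<lambda>x. exp (false_pos n \<theta> k x - 2 * penalty n k))"
    and "(\<integral>x. exp (false_pos n \<theta> k x - 2 * penalty n k) \<partial>law n \<theta>) \<le> 1"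
proof -
  interpret N: prob_space std_normal by (rule prob_space_std_normal)
  interpret P: finite_product_prob_space "\<lambda>_. std_normal" "{1..n}"
    by (rule finite_product_prob_space_std_normal)
  define f :: "nat \<Rightarrow> real \<Rightarrow> real" where
    "f = (\<lambda>i z. exp (of_bool (\<theta> i = 0) * of_bool (2 * real k \<le> z\<^sup>2)))"
  define q where "q = exp (- real k) / sqrt (2 * real k)"
  have [measurable]: "false_pos n \<theta> k \<in> borel_measurable (vec_space n)"
    unfolding false_pos_def vec_space_def by measurable
  have f_int: "integrable std_normal (f i)" for i
    unfolding f_def by (rule N.integrable_const_bound[of _ "exp 1"]) (auto simp: of_bool_def)
  have f_le: "integral\<^sup>L std_normal (f i) \<le> exp (2 * q)" for i
  proof (cases "\<theta> i = 0")
    case True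
    let ?A = "{z::real. 2 * real k \<le> z\<^sup>2}"
    have "integrable std_normal (indicat_real ?A)"
      by (rule integrable_real_indicator) (auto simp: N.emeasure_eq_measure)
    then have ind: "integrable std_normal (\<lambda>z. (exp 1 - 1) * indicat_real ?A z)"
      by (rule integrable_mult_right)
    have "integral\<^sup>L std_normal (f i) = (\<integral>z. 1 + (exp 1 - 1) * indicator ?A z \<partial>std_normal)"
      by (intro Bochner_Integration.integral_cong) (auto simp: f_def True indicator_def)
    also have "\<dots> = 1 + (exp 1 - 1) * measure std_normal ?A"
      by (subst Bochner_Integration.integral_add[OF _ ind]) (auto simp: N.prob_space[simplified])
    \<comment> \<open>Here \<open>exp 1 \<le> 3\<close> gives \<open>exp 1 - 1 \<le> 2\<close>,
      which is where the 2 in \<open>2 * penalty\<close> comes from.\<close>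
    also have "\<dots> \<le> 1 + 2 * q"
      using exp_le std_normal_exceed_le[OF assms] unfolding q_def
      by (intro add_left_mono mult_mono) auto
    also have "\<dots> \<le> exp (2 * q)"
      by (rule exp_ge_add_one_self)
    finally show ?thesis .
  next
    case False
    then show ?thesis
      by (simp add: f_def q_def N.prob_space[simplified])
  qed
  \<comment> \<open>Null coordinates are not shifted and signal coordinates contribute the factor 1,
    so only the noise enters.\<close>
  have prod: "exp (false_pos n \<theta> k (\<lambda>i\<in>{1..n}. \<theta> i + e i)) = (\<Prod>i=1..n. f i (e i))" for e
    unfolding false_pos_def exp_sum[OF finite_atLeastAtMost] f_def by (rule prod.cong) auto
  have "integrable (gauss_noise n) (\<lambda>e. \<Prod>i=1..n. f i (e i))"
    unfolding gauss_noise_eq by (intro P.product_integrable_prod f_int) auto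
  then have int: "integrable (law n \<theta>) (\<lambda>x. exp (false_pos n \<theta> k x))"
    unfolding law_def by (subst integrable_distr_eq) (simp_all add: prod del: One_nat_def)
  then show "integrable (law n \<theta>) (\<lambda>x. exp (false_pos n \<theta> k x - 2 * penalty n k))"
    by (simp add: exp_diff)
  have "(\<integral>x. exp (false_pos n \<theta> k x) \<partial>law n \<theta>) = (\<integral>e. (\<Prod>i=1..n. f i (e i)) \<partial>gauss_noise n)"
    unfolding law_def by (subst integral_distr) (simp_all add: prod del: One_nat_def)
  also have "\<dots> = (\<Prod>i=1..n. integral\<^sup>L std_normal (f i))"
    unfolding gauss_noise_eq by (rule P.product_integral_prod) (auto intro: f_int)
  also have "\<dots> \<le> (\<Prod>i=1..n. exp (2 * q))"
    by (intro prod_mono conjI f_le Bochner_Integration.integral_nonneg) (simp add: f_def)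
  also have "\<dots> = exp (2 * penalty n k)"
    by (simp add: penalty_def q_def exp_of_nat_mult[symmetric] mult.left_commute)
  finally show "(\<integral>x. exp (false_pos n \<theta> k x - 2 * penalty n k) \<partial>law n \<theta>) \<le> 1"
    by (simp add: exp_diff)
qed

text \<open>Linearity suffices, the loss being a sum of one error indicator per coordinate. The
  false rejection bound is charged to all \<open>n\<close> coordinates, which produces
  \<open>penalty n k\<close>.\<close>

lemma integral_L_C_threshold_test:
  assumes "1 \<le> k" "0 < w" and sig: "\<And>i. i \<in> supp n \<theta> \<Longrightarrow> sqrt (2 * real k) + w \<le> \<bar>\<theta> i\<bar>"
  shows "integrable (law n \<theta>) (\<lambda>x. L_C n \<theta> (threshold_test n k x))"
    and "(\<integral>x. L_C n \<theta> (threshold_test n k x) \<partial>law n \<theta>)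
      \<le> penalty n k + real (card (supp n \<theta>)) * (exp (- w\<^sup>2 / 2) / w)"
proof -
  interpret prob_space "law n \<theta>" by (rule prob_space_law)
  define g :: "nat \<Rightarrow> (nat \<Rightarrow> real) \<Rightarrow> real" where
    "g = (\<lambda>i x. of_bool (if \<theta> i = 0 then 2 * real k \<le> (x i)\<^sup>2 else \<not> 2 * real k \<le> (x i)\<^sup>2))"
  have L: "L_C n \<theta> (threshold_test n k x) = (\<Sum>i=1..n. g i x)" for x
    unfolding L_C_def g_def by (rule sum.cong) (auto simp: threshold_test_def)
  have g_int: "integrable (law n \<theta>) (g i)" if "i \<in> {1..n}" for i
  proof -
    note [measurable] = measurable_law_component[OF that, of \<theta>]
    show ?thesis
      unfolding g_def by (rule integrable_const_bound[of _ 1]) auto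
  qed
  then show "integrable (law n \<theta>) (\<lambda>x. L_C n \<theta> (threshold_test n k x))"
    unfolding L by (intro Bochner_Integration.integrable_sum) auto
  have g_le: "(\<integral>x. g i x \<partial>law n \<theta>) \<le> exp (- real k) / sqrt (2 * real k)
      + of_bool (\<theta> i \<noteq> 0) * (exp (- w\<^sup>2 / 2) / w)" if i: "i \<in> {1..n}" for i
  proof (cases "\<theta> i = 0")
    case True
    have "(\<integral>x. g i x \<partial>law n \<theta>) = measure std_normal {z. 2 * real k \<le> (\<theta> i + z)\<^sup>2}"
      unfolding g_def using True
      by (simp add: integral_law_component[OF i, of "\<lambda>y. 2 * real k \<le> y\<^sup>2"])
    then show ?thesis
      using std_normal_exceed_le[OF assms(1)] True by simp
  next
    case False
    have "(\<integral>x. g i x \<partial>law n \<theta>) = measure std_normal {z. \<not> 2 * real k \<le> (\<theta> i + z)\<^sup>2}"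
      unfolding g_def using False
      by (simp add: integral_law_component[OF i, of "\<lambda>y. \<not> 2 * real k \<le> y\<^sup>2"])
    also have "\<dots> \<le> exp (- w\<^sup>2 / 2) / w"
      using False i assms(2) by (intro std_normal_miss_le sig) (auto simp: supp_def)
    finally show ?thesis
      using False by (simp add: add_increasing)
  qed
  have "(\<integral>x. L_C n \<theta> (threshold_test n k x) \<partial>law n \<theta>) = (\<Sum>i=1..n. (\<integral>x. g i x \<partial>law n \<theta>))"
    unfolding L by (rule Bochner_Integration.integral_sum) (rule g_int)
  also have "\<dots> \<le> (\<Sum>i=1..n. exp (- real k) / sqrt (2 * real k)
      + of_bool (\<theta> i \<noteq> 0) * (exp (- w\<^sup>2 / 2) / w))"
    by (intro sum_mono g_le)
  also have "\<dots> = penalty n k + real (card (supp n \<theta>)) * (exp (- w\<^sup>2 / 2) / w)"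
    unfolding sum.distrib sum_distrib_right[symmetric]
    by (simp add: penalty_def supp_def of_bool_def sum.If_cases Int_def)
  finally show "(\<integral>x. L_C n \<theta> (threshold_test n k x) \<partial>law n \<theta>)
      \<le> penalty n k + real (card (supp n \<theta>)) * (exp (- w\<^sup>2 / 2) / w)" .
qed

text \<open>Of the 5 penalties, one bounds the false rejections at level \<open>k\<close> and four
  come from the comparison of levels; each exponential has mean at most 1, giving
  \<open>2 * levels n\<close>. The factor 3 is 2 for the false discovery proportion plus 1 for the
  missed signals.\<close>

lemma adaptive_test_risk_le:
  assumes k: "k \<in> {1..levels n}" and "0 < w" "supp n \<theta> \<noteq> {}"
    and sig: "\<And>i. i \<in> supp n \<theta> \<Longrightarrow> sqrt (2 * real k) + w \<le> \<bar>\<theta> i\<bar>"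
    and B: "5 * penalty n k + real (card (supp n \<theta>)) * (exp (- w\<^sup>2 / 2) / w) + 2 * real (levels n) \<le> B"
  shows "C_risk n \<theta> (adaptive_test n) \<le> B"
    and "R_risk n \<theta> (adaptive_test n) \<le> 3 * (B / real (card (supp n \<theta>)))"
proof -
  interpret prob_space "law n \<theta>" by (rule prob_space_law)
  \<comment> \<open>An integrable nonnegative majorant of the adaptive loss;
    \<open>integral_mono'\<close> takes its integrability from this side.\<close>
  define h where "h = (\<lambda>x. L_C n \<theta> (threshold_test n k x) + 4 * penalty n k
       + 2 * (\<Sum>j=1..levels n. exp (false_pos n \<theta> j x - 2 * penalty n j)))"
  define s where "s = real (card (supp n \<theta>))"
  have "finite (supp n \<theta>)" by (simp add: supp_def)
  then have s: "1 \<le> s"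
    using assms(3) by (simp add: s_def Suc_le_eq card_gt_0_iff)
  have k1: "1 \<le> k" using k by simp
  note T = integral_L_C_threshold_test[of k w n \<theta>, OF k1 assms(2) sig]
  have S: "integrable (law n \<theta>) (\<lambda>x. (\<Sum>j=1..levels n. exp (false_pos n \<theta> j x - 2 * penalty n j)))"
    by (intro Bochner_Integration.integrable_sum integral_exp_false_pos) auto
  have h_int: "integrable (law n \<theta>) h"
    unfolding h_def using T(1) S by auto
  have "(\<integral>x. (\<Sum>j=1..levels n. exp (false_pos n \<theta> j x - 2 * penalty n j)) \<partial>law n \<theta>)
      = (\<Sum>j=1..levels n. (\<integral>x. exp (false_pos n \<theta> j x - 2 * penalty n j) \<partial>law n \<theta>))"
    by (intro Bochner_Integration.integral_sum integral_exp_false_pos) auto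
  also have "\<dots> \<le> (\<Sum>j=1..levels n. 1)"
    by (intro sum_mono integral_exp_false_pos) auto
  finally have "(\<integral>x. (\<Sum>j=1..levels n. exp (false_pos n \<theta> j x - 2 * penalty n j)) \<partial>law n \<theta>)
      \<le> real (levels n)" by simp
  moreover have "integral\<^sup>L (law n \<theta>) h = (\<integral>x. L_C n \<theta> (threshold_test n k x) \<partial>law n \<theta>) + 4 * penalty n k
      + 2 * (\<integral>x. (\<Sum>j=1..levels n. exp (false_pos n \<theta> j x - 2 * penalty n j)) \<partial>law n \<theta>)"
    unfolding h_def using T(1) S by (simp add: prob_space del: Bochner_Integration.integral_sum)
  ultimately have hB: "integral\<^sup>L (law n \<theta>) h \<le> B"
    using T(2) B by linarith
  have Lh: "L_C n \<theta> (adaptive_test n x) \<le> h x" for x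
    unfolding h_def by (rule L_C_adaptive_test_le[OF k])
  have L0: "0 \<le> L_C n \<theta> d" for d
    unfolding L_C_def by (intro sum_nonneg) auto
  have "C_risk n \<theta> (adaptive_test n) \<le> integral\<^sup>L (law n \<theta>) h"
    unfolding C_risk_def using L0 Lh order_trans by (intro integral_mono'[OF h_int]) blast+
  with hB show "C_risk n \<theta> (adaptive_test n) \<le> B" by simp
  have d01: "adaptive_test n x i \<in> {0, 1}" if "i \<in> {1..n}" for i x
    using that
    by (auto simp: adaptive_test_def threshold_test_def)
  have "FDR n \<theta> (adaptive_test n) \<le> (\<integral>x. 2 * (h x / s) \<partial>law n \<theta>)"
    unfolding FDR_def
  proof (rule integral_mono')
    show "integrable (law n \<theta>) (\<lambda>x. 2 * (h x / s))"
      using h_int by auto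
  next
    fix x
    have "L_C n \<theta> (adaptive_test n x) / s \<le> h x / s"
      using s Lh by (intro divide_right_mono) auto
    then show "(\<Sum>i=1..n. of_bool (\<theta> i = 0) * real (adaptive_test n x i)) /
          max 1 (\<Sum>i=1..n. real (adaptive_test n x i)) \<le> 2 * (h x / s)"
      using false_discovery_proportion_le[OF assms(3), of "adaptive_test n x"] d01 unfolding s_def
      by (smt (verit))
    show "0 \<le> 2 * (h x / s)"
      using s L0[of "adaptive_test n x"] Lh[of x] by simp
  qed
  moreover have "FNR n \<theta> (adaptive_test n) \<le> (\<integral>x. h x / s \<partial>law n \<theta>)"
    unfolding FNR_def
  proof (rule integral_mono')
    show "integrable (law n \<theta>) (\<lambda>x. h x / s)"
      using h_int by auto
  next
    fix x
    have "(\<Sum>i=1..n. of_bool (\<theta> i \<noteq> 0) * (1 - real (adaptive_test n x i)))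
        \<le> L_C n \<theta> (adaptive_test n x)"
      unfolding L_C_def by (rule sum_mono) auto
    also note Lh
    finally show "(\<Sum>i=1..n. of_bool (\<theta> i \<noteq> 0) * (1 - real (adaptive_test n x i))) /
          max 1 (real (card (supp n \<theta>))) \<le> h x / s"
      using s unfolding s_def[symmetric] by (simp add: max_def divide_right_mono)
    show "0 \<le> h x / s"
      using s L0[of "adaptive_test n x"] Lh[of x] by simp
  qed
  ultimately have "R_risk n \<theta> (adaptive_test n) \<le> 3 * (integral\<^sup>L (law n \<theta>) h / s)"
    unfolding R_risk_def by simp
  also have "\<dots> \<le> 3 * (B / s)"
    using hB s by (intro mult_left_mono divide_right_mono) auto
  finally show "R_risk n \<theta> (adaptive_test n) \<le> 3 * (B / real (card (supp n \<theta>)))"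
    by (simp add: s_def)
qed

section \<open>Exponents on \<open>J\<close> and the resulting rates\<close>

lemma J_bounds:
  fixes \<beta> r \<epsilon> :: real
  defines "u \<equiv> (sqrt r - \<beta> / sqrt r) / 2" and "t \<equiv> (sqrt r + \<beta> / sqrt r) / 2"
  assumes "0 < \<epsilon>" "(\<beta>, r) \<in> J \<epsilon>"
  shows "t + u = sqrt r" "u\<^sup>2 = kappa r \<beta>" "t\<^sup>2 = kappa r \<beta> + \<beta>"
    "\<epsilon> / 4 \<le> u" "u \<le> t" "kappa r \<beta> + \<beta> \<le> 1 - \<epsilon>\<^sup>2 / 8" "\<epsilon> \<le> kappa r \<beta> + \<beta>" "\<epsilon> \<le> 1"
proof -
  define x where "x = sqrt r"
  define q where "q = sqrt (1 - \<beta>)"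
  have \<beta>: "\<epsilon> \<le> \<beta>" "\<beta> \<le> 1 - \<epsilon>" and r: "\<beta> + \<epsilon> \<le> r" "r \<le> (1 + q)\<^sup>2 - \<epsilon>"
    using assms(4) by (auto simp: J_def q_def)
  then show "\<epsilon> \<le> 1" using assms(3) by linarith
  have x: "0 < x" "x\<^sup>2 = r" using \<beta> r assms(3) by (auto simp: x_def)
  have q2: "q\<^sup>2 = 1 - \<beta>" using \<beta> assms(3) by (simp add: q_def)
  have q1: "q \<le> 1" using \<beta> assms(3) by (simp add: q_def)
  have q0: "\<epsilon> \<le> q"
  proof -
    have "\<epsilon>\<^sup>2 \<le> \<epsilon>" using \<open>\<epsilon> \<le> 1\<close> assms(3) by (simp add: power2_eq_square mult_left_le)
    then show ?thesis unfolding q_def using \<beta> by (intro real_le_rsqrt) linarith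
  qed
  have u: "u = (x - \<beta> / x) / 2" and t: "t = (x + \<beta> / x) / 2"
    by (simp_all add: u_def t_def x_def)
  \<comment> \<open>In units of \<open>sqrt (2 * ln n)\<close>, \<open>t\<close> is the ideal
    threshold and \<open>u\<close> its distance to the smallest signal. Their squares are the
    exponents of false rejections and of misses, which differ by the sparsity exponent
    \<open>\<beta>\<close>.\<close>
  show "t + u = sqrt r" by (simp add: u t x_def field_simps)
  show uk: "u\<^sup>2 = kappa r \<beta>" by (simp add: u_def kappa_def)
  have tu: "t\<^sup>2 = u\<^sup>2 + \<beta>"
    using x(1) by (simp add: u t power2_eq_square field_simps)
  then show "t\<^sup>2 = kappa r \<beta> + \<beta>" by (simp add: uk)
  show "u \<le> t" using x(1) \<beta> assms(3) by (simp add: u t)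
  have xq: "x < 1 + q"
  proof (rule power2_less_imp_less)
    show "x\<^sup>2 < (1 + q)\<^sup>2" using x r assms(3) by simp
  qed (use q0 assms(3) in simp)
  \<comment> \<open>Since \<open>x < 1 + q \<le> 2\<close>, the identity
    \<open>x^2 - \<beta> = u * (2 * x)\<close> converts the margin of \<open>r\<close> over
    \<open>\<beta>\<close> into one for \<open>u\<close>.\<close>
  have "\<epsilon> / 4 * (2 * x) \<le> \<epsilon> / 4 * 4"
    using xq q1 assms(3) by (intro mult_left_mono) auto
  also have "\<dots> \<le> x\<^sup>2 - \<beta>" using r x by simp
  also have ux: "x\<^sup>2 - \<beta> = u * (2 * x)" using x(1) by (simp add: u power2_eq_square field_simps)
  finally show ue: "\<epsilon> / 4 \<le> u"
    using x(1) by (simp add: mult_le_cancel_right)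
  have "0 \<le> u" using ue assms(3) by simp
  show "\<epsilon> \<le> kappa r \<beta> + \<beta>"
    using \<beta>(1) uk zero_le_power2[of u] by linarith
  have "\<epsilon> \<le> (1 + q - x) * (1 + q + x)"
    using r x by (simp add: power2_eq_square algebra_simps)
  also have "\<dots> \<le> (1 + q - x) * 4"
    using xq q1 by (intro mult_left_mono) auto
  finally have gap: "\<epsilon> / 4 \<le> 1 + q - x" by simp
  \<comment> \<open>Transfers the gap at the upper boundary of \<open>J\<close> to
    \<open>q - u\<close>: the right side is \<open>1 - (x - q)^2\<close>, which equals
    \<open>(2 * q - 2 * u) * x\<close> because \<open>q^2 = 1 - \<beta>\<close>.\<close>
  have "(1 + q - x) * x \<le> (1 + q - x) * (x + 1 - q)"
    using xq q1 by (intro mult_left_mono) auto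
  also have "\<dots> = (2 * q - 2 * u) * x"
    using ux q2 by (simp add: power2_eq_square algebra_simps)
  finally have "1 + q - x \<le> 2 * q - 2 * u"
    using x(1) by (simp add: mult_le_cancel_right)
  with gap have "\<epsilon> / 8 \<le> q - u" by simp
  moreover have "\<epsilon> \<le> q + u" using q0 \<open>0 \<le> u\<close> by simp
  ultimately have "\<epsilon> / 8 * \<epsilon> \<le> (q - u) * (q + u)"
    using assms(3) by (intro mult_mono) auto
  also have "\<dots> = 1 - \<beta> - kappa r \<beta>"
    by (simp add: uk[symmetric] q2[symmetric] power2_eq_square algebra_simps)
  finally show "kappa r \<beta> + \<beta> \<le> 1 - \<epsilon>\<^sup>2 / 8"
    by (simp add: power2_eq_square)
qed

text \<open>In \<open>C\<close>, \<open>5 / \<epsilon>\<close> pays for the penalties,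
  \<open>24 * b / \<epsilon>\<close> for the missed signals and 2 for the levels. The first
  condition on \<open>n\<close> leaves room for rounding the level to an integer, the second absorbs
  the number of levels.\<close>

lemma adaptive_test_rates:
  fixes a b \<epsilon> \<beta> r :: real
  defines "C \<equiv> 5 / \<epsilon> + 24 * b / \<epsilon> + 2"
  assumes "0 < a" "a < b" and \<epsilon>: "0 < \<epsilon>" and J: "(\<beta>, r) \<in> J \<epsilon>" and \<theta>: "\<theta> \<in> Theta a b n r \<beta>"
    and n: "4 / \<epsilon>\<^sup>2 \<le> ln (real n)" "real (levels n) \<le> real n powr (\<epsilon>\<^sup>2 / 8) / sqrt (ln (real n))"
  shows "C_risk n \<theta> (adaptive_test n) \<le> C * v_C n r \<beta>"
    and "R_risk n \<theta> (adaptive_test n) \<le> 3 * C / a * v_R n r \<beta>"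
proof -
  define L where "L = ln (real n)"
  define \<kappa> where "\<kappa> = kappa r \<beta>"
  define u where "u = sqrt (2 * L) * ((sqrt r - \<beta> / sqrt r) / 2)"
  define t where "t = sqrt (2 * L) * ((sqrt r + \<beta> / sqrt r) / 2)"
  define s where "s = real (card (supp n \<theta>))"
  define k where "k = nat \<lceil>(\<kappa> + \<beta>) * L\<rceil>"
  note bds = J_bounds[OF \<epsilon> J, folded \<kappa>_def]
  have "0 < 4 / \<epsilon>\<^sup>2" using \<epsilon> by simp
  then have L: "0 < L" "4 / \<epsilon>\<^sup>2 \<le> L" using n(1) unfolding L_def by linarith+
  have n0: "1 < real n"
    using L(1) unfolding L_def by (metis ln_gt_zero_iff ln_0 less_irrefl of_nat_0_less_iff of_nat_0 gr0I)
  have npow: "exp (- (c * L)) = real n powr (- c)" "exp (c * L) = real n powr c" for c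
    using n0 by (simp_all add: powr_def L_def)
  have u2: "u\<^sup>2 = 2 * (\<kappa> * L)" and t2: "t\<^sup>2 = 2 * ((\<kappa> + \<beta>) * L)"
    unfolding u_def t_def power_mult_distrib bds(2,3) using L(1) by simp_all
  have tu: "t + u = sqrt (2 * r * L)"
    using bds(1) unfolding t_def u_def distrib_left[symmetric]
    by (simp add: real_sqrt_mult)
  have ut: "u \<le> t" unfolding u_def t_def using bds(5) L(1) by (intro mult_left_mono) auto
  have "sqrt L \<le> sqrt (2 * L)" using L(1) by simp
  then have u_ge: "sqrt L * (\<epsilon> / 4) \<le> u"
    unfolding u_def using bds(4) \<epsilon> L(1) by (intro mult_mono) auto
  have u0: "0 < u" using u_ge L(1) \<epsilon> by (smt (verit) mult_pos_pos real_sqrt_gt_zero zero_less_divide_iff)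
  have t0: "0 < t" using ut u0 by simp
  \<comment> \<open>A square as lower bound makes the later bounds on \<open>t\<close> and
    \<open>sqrt (2 * real k)\<close> linear in \<open>\<epsilon>\<close>.\<close>
  have \<epsilon>2: "\<epsilon> * \<epsilon> \<le> \<kappa> + \<beta>"
    using bds(7,8) \<epsilon> mult_left_le[of \<epsilon> \<epsilon>] by linarith
  have t_ge: "\<epsilon> * sqrt (2 * L) \<le> t"
  proof (rule power2_le_imp_le)
    have "(\<epsilon> * \<epsilon>) * (2 * L) \<le> (\<kappa> + \<beta>) * (2 * L)"
      using \<epsilon>2 L(1) by (intro mult_right_mono) auto
    then show "(\<epsilon> * sqrt (2 * L))\<^sup>2 \<le> t\<^sup>2"
      unfolding t2 power_mult_distrib using L(1) by (simp add: power2_eq_square[of \<epsilon>])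
  qed (use t0 in simp)
  \<comment> \<open>The product equals \<open>L * \<epsilon>^2 / 2\<close>; this is why
    \<open>L\<close> must reach \<open>4 / \<epsilon>^2\<close>.\<close>
  have "2 \<le> sqrt (2 * L) * (\<epsilon> / 4) * (\<epsilon> * sqrt (2 * L))"
  proof -
    have "sqrt (2 * L) * (\<epsilon> / 4) * (\<epsilon> * sqrt (2 * L)) = (sqrt (2 * L))\<^sup>2 * \<epsilon>\<^sup>2 / 4"
      unfolding power2_eq_square by simp
    also have "\<dots> = L * \<epsilon>\<^sup>2 / 2" using L(1) by simp
    finally have eq: "sqrt (2 * L) * (\<epsilon> / 4) * (\<epsilon> * sqrt (2 * L)) = L * \<epsilon>\<^sup>2 / 2" .
    have "4 \<le> L * \<epsilon>\<^sup>2" using L(2) \<epsilon> by (simp add: pos_divide_le_eq)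
    then show ?thesis unfolding eq by simp
  qed
  also have "\<dots> \<le> u * t"
    unfolding u_def using bds(4) L(1) \<epsilon> t_ge by (intro mult_mono mult_left_mono) auto
  finally have ut2: "1 / t \<le> u / 2" using t0 by (simp add: pos_divide_le_eq)
  \<comment> \<open>Rounding the level raises the threshold \<open>t\<close> by at most
    \<open>1 / t\<close>, so \<open>w\<close> is what surely remains of the distance
    \<open>u\<close> to the signals.\<close>
  define w where "w = u - 1 / t"
  have w: "0 < w" "u / 2 \<le> w" using ut2 u0 by (auto simp: w_def)
  have kL: "0 < (\<kappa> + \<beta>) * L" using bds(7) \<epsilon> L(1) by simp
  have k: "(\<kappa> + \<beta>) * L \<le> real k" "real k \<le> (\<kappa> + \<beta>) * L + 1" and k0: "0 < k"
    using kL unfolding k_def by linarith+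
  have "\<kappa> + \<beta> \<le> 1"
    using bds(6) zero_le_power2[of \<epsilon>] by linarith
  then have "(\<kappa> + \<beta>) * L \<le> 1 * L"
    using L(1) by (intro mult_right_mono) auto
  then have "k \<le> nat \<lceil>L\<rceil>"
    unfolding k_def by (intro nat_mono ceiling_mono) simp
  then have k_levels: "k \<in> {1..levels n}"
    using k0 unfolding levels_def L_def[symmetric] by simp
  \<comment> \<open>Rounding \<open>t\<^sup>2 / 2\<close> up to \<open>k\<close> costs only a constant factor in the tail at \<open>u\<close>, as \<open>u \<le> t\<close>.\<close>
  have "sqrt (2 * real k) \<le> t + 1 / t"
  proof (rule real_le_lsqrt)
    have "2 * real k \<le> t\<^sup>2 + 2" using k(2) t2 by simp
    also have "\<dots> \<le> (t + 1 / t)\<^sup>2" using t0 by (simp add: power2_sum power_divide)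
    finally show "2 * real k \<le> (t + 1 / t)\<^sup>2" .
  qed (use t0 in auto)
  then have kw: "sqrt (2 * real k) + w \<le> sqrt (2 * r * L)"
    unfolding w_def using tu by simp
  have s: "a * real n powr (1 - \<beta>) \<le> s" "s \<le> b * real n powr (1 - \<beta>)"
    and sig: "i \<in> supp n \<theta> \<Longrightarrow> sqrt (2 * r * L) \<le> \<bar>\<theta> i\<bar>" for i
    using \<theta> unfolding Theta_def s_def L_def by auto
  have "0 < a * real n powr (1 - \<beta>)" using n0 assms(2) by simp
  then have s0: "0 < s" using s(1) by simp
  then have ne: "supp n \<theta> \<noteq> {}" unfolding s_def by auto
  have sig': "sqrt (2 * real k) + w \<le> \<bar>\<theta> i\<bar>" if "i \<in> supp n \<theta>" for i
    using kw sig[OF that] by simp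
  define v where "v = v_C n r \<beta>"
  have v: "v = real n powr (1 - \<beta>) * (real n powr (- \<kappa>) / sqrt L)"
    by (simp add: v_def v_C_def v_R_def \<kappa>_def L_def)
  have v0: "0 \<le> v" unfolding v using L(1) by simp
  have pen: "penalty n k \<le> v / \<epsilon>"
  proof -
    have "\<epsilon> * sqrt L \<le> sqrt (2 * real k)"
    proof (rule real_le_rsqrt)
      have "\<epsilon> * \<epsilon> * L \<le> (\<kappa> + \<beta>) * L" using \<epsilon>2 L(1) by (intro mult_right_mono) auto
      then have "\<epsilon> * \<epsilon> * L \<le> 2 * real k" using k(1) by linarith
      then show "(\<epsilon> * sqrt L)\<^sup>2 \<le> 2 * real k"
        unfolding power_mult_distrib using L(1) by (simp add: power2_eq_square[of \<epsilon>])
    qed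
    then have "exp (- real k) / sqrt (2 * real k) \<le> exp (- ((\<kappa> + \<beta>) * L)) / (\<epsilon> * sqrt L)"
      using k(1) \<epsilon> L(1) by (intro frac_le) auto
    then have "penalty n k \<le> real n * (exp (- ((\<kappa> + \<beta>) * L)) / (\<epsilon> * sqrt L))"
      unfolding penalty_def by (intro mult_left_mono) auto
    also have "\<dots> = v / \<epsilon>"
    proof -
      have "real n powr (1 - \<beta>) * real n powr (- \<kappa>) = real n * real n powr (- (\<kappa> + \<beta>))"
        using n0 by (simp add: powr_add[symmetric] powr_mult_base algebra_simps)
      then show ?thesis unfolding v npow by simp
    qed
    finally show ?thesis .
  qed
  \<comment> \<open>Since \<open>u / t \<le> 1\<close>, \<open>w^2 \<ge> u^2 - 2\<close>, which
    costs a factor \<open>exp 1 \<le> 3\<close>; together with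
    \<open>w \<ge> u / 2 \<ge> sqrt L * (\<epsilon> / 8)\<close> this gives
    \<open>24 = 3 * 8\<close>.\<close>
  have miss: "s * (exp (- w\<^sup>2 / 2) / w) \<le> 24 * b / \<epsilon> * v"
  proof -
    have "u * (1 / t) \<le> 1" using ut t0 by simp
    moreover have "w\<^sup>2 = u\<^sup>2 + (1 / t)\<^sup>2 - 2 * (u * (1 / t))"
      by (simp add: w_def power2_diff)
    ultimately have "- w\<^sup>2 / 2 \<le> 1 - \<kappa> * L"
      using u2 zero_le_power2[of "1 / t"] by linarith
    then have "exp (- w\<^sup>2 / 2) \<le> exp (1 - \<kappa> * L)" by simp
    also have "\<dots> = exp 1 * exp (- (\<kappa> * L))" by (simp flip: exp_add)
    also have "\<dots> \<le> 3 * exp (- (\<kappa> * L))" using exp_le by (intro mult_right_mono) auto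
    finally have "exp (- w\<^sup>2 / 2) \<le> 3 * real n powr (- \<kappa>)" unfolding npow .
    moreover have "sqrt L * (\<epsilon> / 8) \<le> w" using w(2) u_ge by simp
    ultimately have "exp (- w\<^sup>2 / 2) / w \<le> 3 * real n powr (- \<kappa>) / (sqrt L * (\<epsilon> / 8))"
      using L(1) \<epsilon> by (intro frac_le) auto
    then have "s * (exp (- w\<^sup>2 / 2) / w)
        \<le> (b * real n powr (1 - \<beta>)) * (3 * real n powr (- \<kappa>) / (sqrt L * (\<epsilon> / 8)))"
      using s(2) assms(2,3) w(1) by (intro mult_mono) auto
    also have "\<dots> = 24 * b / \<epsilon> * v" unfolding v by (simp add: mult_ac)
    finally show ?thesis .
  qed
  \<comment> \<open>The exponent \<open>1 - \<beta> - \<kappa>\<close> of \<open>v\<close> is at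
    least \<open>\<epsilon>^2 / 8\<close> on \<open>J\<close>, so a power of \<open>n\<close>
    dominates the logarithmic cost.\<close>
  have lev: "real (levels n) \<le> v"
  proof -
    have "real n powr (\<epsilon>\<^sup>2 / 8) \<le> real n powr (1 - \<beta> - \<kappa>)"
      using n0 bds(6) by (intro powr_mono) auto
    also have "\<dots> = real n powr (1 - \<beta>) * real n powr (- \<kappa>)"
      by (simp flip: powr_add)
    finally have "real n powr (\<epsilon>\<^sup>2 / 8) / sqrt L \<le> v"
      unfolding v using L(1) by (simp add: divide_right_mono)
    then show ?thesis using n(2) by (simp add: L_def)
  qed
  have "5 * penalty n k + s * (exp (- w\<^sup>2 / 2) / w) + 2 * real (levels n) \<le> C * v"
    using pen miss lev unfolding C_def by (simp add: distrib_right)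
  note risk = adaptive_test_risk_le[where \<theta> = \<theta>, OF k_levels w(1) ne sig' this[unfolded s_def]]
  then show "C_risk n \<theta> (adaptive_test n) \<le> C * v_C n r \<beta>"
    by (simp add: v_def)
  have "0 \<le> C" unfolding C_def using assms(2,3) \<epsilon> by simp
  have "R_risk n \<theta> (adaptive_test n) \<le> 3 * (C * v / s)"
    using risk(2) by (simp add: s_def)
  also have "\<dots> \<le> 3 * (C * v / (a * real n powr (1 - \<beta>)))"
    using s(1) s0 \<open>0 < a * real n powr (1 - \<beta>)\<close> \<open>0 \<le> C\<close> v0
    by (intro mult_left_mono divide_left_mono) auto
  also have "\<dots> = 3 * C / a * v_R n r \<beta>"
    using n0 by (simp add: v_def v_C_def)
  finally show "R_risk n \<theta> (adaptive_test n) \<le> 3 * C / a * v_R n r \<beta>" .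
qed

section \<open>Large \<open>n\<close> and the uniform bound\<close>

lemma eventually_levels_le:
  assumes "0 < c"
  shows "\<forall>\<^sub>F n in sequentially. real (levels n) \<le> real n powr c / sqrt (ln (real n))"
proof -
  \<comment> \<open>The 2 covers the \<open>Suc\<close> and the ceiling in
    \<open>levels\<close>.\<close>
  have "\<forall>\<^sub>F n in sequentially. ln (real n) + 2 \<le> real n powr c / sqrt (ln (real n))"
    using assms by real_asymp
  moreover have "\<forall>\<^sub>F n in sequentially. 0 \<le> ln (real n)"
    by real_asymp
  ultimately show ?thesis
  proof eventually_elim
    case (elim n)
    then have "real (levels n) \<le> ln (real n) + 2"
      unfolding levels_def by linarith
    with elim show ?case by linarith
  qed
qed

theorem mainTheorem11:
  fixes a b \<epsilon> :: real
  assumes "0 < a" and "a < b" and "0 < \<epsilon>"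
  shows "\<exists>(\<phi> :: nat \<Rightarrow> (nat \<Rightarrow> real) \<Rightarrow> nat \<Rightarrow> nat) (C :: real).
           (\<forall>n. procedure n (\<phi> n)) \<and> 0 < C \<and>
           (\<forall>\<^sub>F n in sequentially.
              (SUP (\<beta>, r) \<in> J \<epsilon>. SUP \<theta> \<in> Theta a b n r \<beta>.
                 ereal (C_risk n \<theta> (\<phi> n) / v_C n r \<beta>)) \<le> ereal C \<and>
              (SUP (\<beta>, r) \<in> J \<epsilon>. SUP \<theta> \<in> Theta a b n r \<beta>.
                 ereal (R_risk n \<theta> (\<phi> n) / v_R n r \<beta>)) \<le> ereal C)"
proof -
  define C where "C = 5 / \<epsilon> + 24 * b / \<epsilon> + 2"
  have C: "0 < C" using assms unfolding C_def by (simp add: add_pos_pos)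
  have "\<forall>\<^sub>F n in sequentially. 4 / \<epsilon>\<^sup>2 \<le> ln (real n)"
    by real_asymp
  moreover have "\<forall>\<^sub>F n in sequentially. real (levels n) \<le> real n powr (\<epsilon>\<^sup>2 / 8) / sqrt (ln (real n))"
    using assms(3) by (intro eventually_levels_le) simp
  moreover have "\<forall>\<^sub>F n in sequentially. 0 < ln (real n)"
    by real_asymp
  moreover have "\<forall>\<^sub>F n in sequentially. 0 < real n"
    by real_asymp
  \<comment> \<open>One constant serves both risks: \<open>C\<close> for the classification loss,
    \<open>3 * C / a\<close> after division by the number of signals.\<close>
  ultimately have "\<forall>\<^sub>F n in sequentially.
              (SUP (\<beta>, r) \<in> J \<epsilon>. SUP \<theta> \<in> Theta a b n r \<beta>.
                 ereal (C_risk n \<theta> (adaptive_test n) / v_C n r \<beta>)) \<le> ereal (max C (3 * C / a)) \<and>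
              (SUP (\<beta>, r) \<in> J \<epsilon>. SUP \<theta> \<in> Theta a b n r \<beta>.
                 ereal (R_risk n \<theta> (adaptive_test n) / v_R n r \<beta>)) \<le> ereal (max C (3 * C / a))"
  proof eventually_elim
    case (elim n)
    have v: "0 < v_R n r \<beta>" "0 < v_C n r \<beta>" for r \<beta>
      using elim(3,4) by (simp_all add: v_R_def v_C_def)
    have rates: "C_risk n \<theta> (adaptive_test n) / v_C n r \<beta> \<le> max C (3 * C / a)"
      "R_risk n \<theta> (adaptive_test n) / v_R n r \<beta> \<le> max C (3 * C / a)"
      if "(\<beta>, r) \<in> J \<epsilon>" "\<theta> \<in> Theta a b n r \<beta>" for \<beta> r \<theta>
      using adaptive_test_rates[OF assms that elim(1,2), folded C_def] v[of r \<beta>]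
      by (simp_all add: pos_divide_le_eq le_max_iff_disj)
    show ?case
      by (auto intro!: SUP_least rates simp del: ereal_max)
  qed
  with C procedure_adaptive_test show ?thesis
    by (intro exI[of _ adaptive_test] exI[of _ "max C (3 * C / a)"]) auto
qed

end
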